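(* Let $n\geq 2$, and let $\mathbf a_n=a_0a_1a_2\cdots$ be the Arshon word of order $n$. Then the critical exponent of $\mathbf a_n$ is $E(\mathbf a_n)=\frac{3n-2}{2n-2}$, and $E(\mathbf a_n)$ is attained by a subword beginning at position $1$ (that is, some subword $a_1a_2\cdots a_j$ of $\mathbf a_n$ is a $\frac{3n-2}{2n-2}$-power).
   Context: Arshon words. For $n=2$, $\mathbf a_2$ is the Thue–Morse word $\mathbf t=01101001\cdots$ over $\{0,1\}$ (the fixed point, starting with $0$, of the morphism $0\mapsto 01$, $1\mapsto 10$). For $n\ge 3$, let $\Sigma_n=\{0,1,\ldots,n-1\}$, with all sums and differences of letters taken modulo $n$. For $a\in\Sigma_n$ put $\varphi_{e,n}(a)=a(a+1)\cdots(n-1)01\cdots(a-2)(a-1)$ (the word of length $n$ whose $t$-th letter, $0\le t<n$, is $a+t$) and $\varphi_{o,n}(a)=(a-1)(a-2)\cdots 10(n-1)\cdots(a+1)a$ (the word of length $n$ whose $t$-th letter, $0\le t<n$, is $a-1-t$). For a word $u=u_0u_1u_2\cdots u_m$ over $\Sigma_n$ put $\varphi_n(u)=\varphi_{e,n}(u_0)\varphi_{o,n}(u_1)\varphi_{e,n}(u_2)\varphi_{o,n}(u_3)\cdots$ ($\varphi_{e,n}$ is applied to letters at even positions and $\varphi_{o,n}$ to letters at odd positions). Each $\varphi_n^k(0)$ is a prefix of $\varphi_n^{k+1}(0)$, and $\mathbf a_n=\lim_{k\to\infty}\varphi_n^k(0)$. Positions are numbered from $0$; a subword is a finite contiguous block.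 Powers. A nonempty finite word $z$ is an $r$-power, $r\in\mathbb Q_{\ge 1}$, if $z=x^my$ with $x$ a nonempty word, $m\geq 1$ an integer, $y$ a (possibly empty) prefix of $x$, and $|z|/|x|=r$. The critical exponent $E(\mathbf w)$ of an infinite word $\mathbf w$ is the supremum of all $r\in\mathbb Q_{\ge1}$ such that $\mathbf w$ contains an $r$-power as a subword; it is attained if $\mathbf w$ contains an $E(\mathbf w)$-power. *)

theory Defs
  imports "HOL-Library.Sublist" "HOL-Library.Extended_Real"
begin

text \<open>Finite words are lists and infinite words are functions on \<open>nat\<close>; the letters of
  \<open>\<Sigma>\<^sub>n\<close> are the naturals below \<open>n\<close>.\<close>

subsection \<open>Limits of chains of finite words\<close>

text \<open>Meaningful for chains \<open>U\<close> in which every \<open>U k\<close> is a prefix of \<open>U (Suc k)\<close> and the lengths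
  are unbounded: position \<open>i\<close> is then read off from any \<open>U k\<close> that is long enough.\<close>

definition word_limit :: "(nat \<Rightarrow> 'a list) \<Rightarrow> nat \<Rightarrow> 'a" where
  "word_limit U i = U (LEAST k. i < length (U k)) ! i"

lemma word_limit_eq_nth:
  assumes chain: "\<And>k. prefix (U k) (U (Suc k))" and "i < length (U k)"
  shows "word_limit U i = U k ! i"
proof -
  define l where "l = (LEAST k. i < length (U k))"
  have l: "i < length (U l)" unfolding l_def using assms(2) by (rule LeastI)
  have "l \<le> k" unfolding l_def using assms(2) by (rule Least_le)
  then have "prefix (U l) (U k)"
    by (induction rule: dec_induct) (auto intro: prefix_order.trans chain)
  then obtain zs where "U k = U l @ zs" by (auto simp: prefix_def)
  with l show ?thesis by (simp add: word_limit_def l_def nth_append)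
qed

subsection \<open>The Thue--Morse word\<close>

definition thue_morse_morphism :: "nat list \<Rightarrow> nat list" where
  "thue_morse_morphism u = concat (map (\<lambda>a. if a = 0 then [0, 1] else [1, 0]) u)"

definition thue_morse :: "nat \<Rightarrow> nat" where
  "thue_morse = word_limit (\<lambda>k. (thue_morse_morphism ^^ k) [0])"

lemma prefix_thue_morse_morphism:
  "prefix u v \<Longrightarrow> prefix (thue_morse_morphism u) (thue_morse_morphism v)"
  by (auto simp: prefix_def thue_morse_morphism_def)

lemma length_thue_morse_morphism: "length (thue_morse_morphism u) = 2 * length u"
  by (induction u) (auto simp: thue_morse_morphism_def)

lemma nth_thue_morse_morphism:
  assumes "i < length u"
  shows "thue_morse_morphism u ! (2 * i) = (if u ! i = 0 then 0 else 1)"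
    and "thue_morse_morphism u ! (2 * i + 1) = (if u ! i = 0 then 1 else 0)"
  using assms
proof (induction u arbitrary: i)
  case (Cons a u)
  { case 1 then show ?case using Cons.IH(1)[of "i - 1"]
      by (cases i) (auto simp: thue_morse_morphism_def) }
  { case 2 then show ?case using Cons.IH(2)[of "i - 1"]
      by (cases i) (auto simp: thue_morse_morphism_def) }
qed simp_all

lemma thue_morse_chain:
  "prefix ((thue_morse_morphism ^^ k) [0]) ((thue_morse_morphism ^^ Suc k) [0])"
proof (induction k)
  case (Suc k)
  then show ?case by (auto dest: prefix_thue_morse_morphism)
qed (simp add: thue_morse_morphism_def)

lemma length_thue_morse_iterate: "length ((thue_morse_morphism ^^ k) [0]) = 2 ^ k"
  by (induction k) (auto simp: length_thue_morse_morphism)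

lemma thue_morse_eq_nth:
  "i < 2 ^ k \<Longrightarrow> thue_morse i = (thue_morse_morphism ^^ k) [0] ! i"
  unfolding thue_morse_def
  by (rule word_limit_eq_nth[where U = "\<lambda>k. (thue_morse_morphism ^^ k) [0]"])
    (simp_all only: thue_morse_chain length_thue_morse_iterate)

text \<open>The word is a fixed point of the morphism and starts with \<open>0\<close>.\<close>

lemma thue_morse_fixed_point:
  shows "thue_morse 0 = 0"
    and "[thue_morse (2 * i), thue_morse (2 * i + 1)] = thue_morse_morphism [thue_morse i]"
proof -
  show "thue_morse 0 = 0" using thue_morse_eq_nth[of 0 0] by simp
  have i: "i < 2 ^ i" by simp
  then have "2 * i < 2 ^ Suc i" "2 * i + 1 < 2 ^ Suc i" unfolding power_Suc by linarith+
  note eq = this[THEN thue_morse_eq_nth] thue_morse_eq_nth[OF i]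
  let ?u = "(thue_morse_morphism ^^ i) [0]"
  have "i < length ?u" using i by (simp only: length_thue_morse_iterate)
  note nth = nth_thue_morse_morphism[OF this]
  have "thue_morse (2 * i) = (if thue_morse i = 0 then 0 else 1)"
    unfolding eq funpow.simps(2) o_apply by (rule nth(1))
  moreover have "thue_morse (2 * i + 1) = (if thue_morse i = 0 then 1 else 0)"
    unfolding eq funpow.simps(2) o_apply by (rule nth(2))
  ultimately show "[thue_morse (2 * i), thue_morse (2 * i + 1)] = thue_morse_morphism [thue_morse i]"
    by (simp add: thue_morse_morphism_def)
qed

subsection \<open>Arshon words\<close>

definition phi_e :: "nat \<Rightarrow> nat \<Rightarrow> nat list" where
  "phi_e n a = map (\<lambda>t. (a + t) mod n) [0..<n]"

text \<open>The letter \<open>a - 1 - t\<close> modulo \<open>n\<close>; adding \<open>n\<close> first avoids truncated subtraction, since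
  \<open>t < n\<close>.\<close>

definition phi_o :: "nat \<Rightarrow> nat \<Rightarrow> nat list" where
  "phi_o n a = map (\<lambda>t. (a + n - 1 - t) mod n) [0..<n]"

definition phi :: "nat \<Rightarrow> nat list \<Rightarrow> nat list" where
  "phi n u = concat (map (\<lambda>i. if even i then phi_e n (u ! i) else phi_o n (u ! i)) [0..<length u])"

text \<open>Order \<open>2\<close> is separate: \<open>phi 2\<close> would generate \<open>010101\<dots>\<close>.\<close>

definition arshon :: "nat \<Rightarrow> nat \<Rightarrow> nat" where
  "arshon n = (if n = 2 then thue_morse else word_limit (\<lambda>k. (phi n ^^ k) [0]))"

lemma phi_o_eq_int:
  assumes "t < n"
  shows "int (phi_o n a ! t) = (int a - 1 - int t) mod int n"
proof -
  have "int (a + n - 1 - t) = (int a - 1 - int t) + int n" using assms by simp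
  then have "int ((a + n - 1 - t) mod n) = (int a - 1 - int t) mod int n"
    by (simp only: zmod_int mod_add_self2)
  then show ?thesis using assms by (simp add: phi_o_def)
qed

lemma prefix_phi: "prefix u v \<Longrightarrow> prefix (phi n u) (phi n v)"
proof (erule prefixE)
  fix w assume v: "v = u @ w"
  have "map (\<lambda>i. if even i then phi_e n (v ! i) else phi_o n (v ! i)) [0..<length u]
      = map (\<lambda>i. if even i then phi_e n (u ! i) else phi_o n (u ! i)) [0..<length u]"
    by (rule map_cong) (auto simp: v nth_append)
  moreover have "[0..<length v] = [0..<length u] @ [length u..<length u + length w]"
    unfolding v length_append by (rule upt_add_eq_append) simp
  ultimately show ?thesis unfolding phi_def by (simp only: map_append concat_append) simp
qed

lemma length_phi: "length (phi n u) = n * length u"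
proof -
  have "map (length \<circ> (\<lambda>i. if even i then phi_e n (u ! i) else phi_o n (u ! i))) [0..<length u]
      = map (\<lambda>_. n) [0..<length u]"
    by (rule map_cong) (auto simp: phi_e_def phi_o_def)
  then show ?thesis unfolding phi_def length_concat map_map by (simp only:) (simp add: sum_list_triv)
qed

lemma phi_chain:
  assumes "n > 0"
  shows "prefix ((phi n ^^ k) [0]) ((phi n ^^ Suc k) [0])"
proof (induction k)
  case 0
  have "[0..<n] = 0 # [1..<n]" using assms by (simp add: upt_conv_Cons)
  then show ?case by (simp add: phi_def phi_e_def)
next
  case (Suc k)
  then show ?case by (simp add: prefix_phi)
qed

lemma length_phi_iterate: "length ((phi n ^^ k) [0]) = n ^ k"
  by (induction k) (auto simp: length_phi)

lemma arshon_eq_nth: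
  assumes "n \<ge> 3" and "i < n ^ k"
  shows "arshon n i = (phi n ^^ k) [0] ! i"
proof -
  have "word_limit (\<lambda>k. (phi n ^^ k) [0]) i = (phi n ^^ k) [0] ! i"
    by (rule word_limit_eq_nth[where U = "\<lambda>k. (phi n ^^ k) [0]"], rule phi_chain)
      (use assms in \<open>simp_all add: length_phi_iterate\<close>)
  with assms(1) show ?thesis by (simp add: arshon_def)
qed

subsection \<open>Powers and critical exponents\<close>

definition is_power :: "rat \<Rightarrow> 'a list \<Rightarrow> bool" where
  "is_power r z \<longleftrightarrow> (\<exists>x m y. x \<noteq> [] \<and> m \<ge> 1 \<and> prefix y x \<and> z = concat (replicate m x) @ y \<and>
     of_nat (length z) / of_nat (length x) = r)"

definition subword :: "'a list \<Rightarrow> (nat \<Rightarrow> 'a) \<Rightarrow> bool" where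
  "subword z w \<longleftrightarrow> (\<exists>i j. z = map w [i..<j])"

text \<open>The supremum is taken in \<open>ereal\<close> because it may be infinite.  The bound \<open>r \<ge> 1\<close> is implied
  by \<open>is_power r z\<close>.\<close>

definition critical_exponent :: "(nat \<Rightarrow> 'a) \<Rightarrow> ereal" where
  "critical_exponent w = (SUP r \<in> {r. \<exists>z. is_power r z \<and> subword z w}. ereal (of_rat r))"

lemma is_power_ge_1: "is_power r z \<Longrightarrow> r \<ge> 1"
proof -
  assume "is_power r z"
  then obtain x m y where x: "x \<noteq> []" and m: "m \<ge> 1"
    and z: "z = concat (replicate m x) @ y"
    and r: "of_nat (length z) / of_nat (length x) = r"
    unfolding is_power_def by (elim exE conjE)
  obtain m' where "m = Suc m'" using m by (cases m) auto
  then have "length x \<le> length z" unfolding z by simp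
  then have "(of_nat (length x) :: rat) \<le> of_nat (length z)" by (rule of_nat_mono)
  then show "r \<ge> 1" using x unfolding r[symmetric] by (simp add: le_divide_eq_1)
qed

end

theory Submission imports Defs "HOL-Number_Theory.Cong" begin

text \<open>A subword of length \<open>p + e\<close> with period \<open>p\<close> is a stretch of \<open>e\<close> consecutive positions \<open>k\<close> with
  \<open>a\<^sub>k = a\<^bsub>k+p\<^esub>\<close>, and its exponent is \<open>1 + e / p\<close>.  The theorem therefore says that \<open>e (2n - 2) \<le> n p\<close>
  for every such stretch, with equality for some stretch that starts at position \<open>1\<close>: with \<open>p = 2n - 2\<close>
  and \<open>e = n\<close> if \<open>n \<ge> 3\<close>, and with \<open>p = e = 1\<close> if \<open>n = 2\<close>.

  Let \<open>n \<ge> 3\<close>.  Neighbouring letters of the Arshon word differ by \<open>1\<close> or \<open>-1\<close> modulo \<open>n\<close>, and the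
  sequence \<open>d\<close> of these steps is transparent (\<open>arshon_step\<close>, \<open>arshon_Suc\<close>): the block of length \<open>n\<close>
  that replaces the \<open>K\<close>-th letter has all its inner steps equal to \<open>(-1)\<^sup>K\<close>, and the step from this
  block to the next one is \<open>d\<^sub>K\<close>.  A stretch of \<open>e\<close> equal letters at distance \<open>p\<close> forces \<open>e - 1\<close>
  equal steps at distance \<open>p\<close>.  Write \<open>p = n q + r\<close> with \<open>0 \<le> r < n\<close>.

  \<^item> If \<open>q = 0\<close>, both letters lie in one block or in two neighbouring blocks of opposite direction,
    so \<open>e \<le> 1\<close>, and \<open>e = 0\<close> when \<open>p = 1\<close>.

  \<^item> If \<open>q\<close> is even and \<open>r = 0\<close>, the stretch is the image of a stretch with period \<open>q\<close>, and induction
    applies: the period grows by the factor \<open>n\<close>, the length of the stretch by at most \<open>n\<close>.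

  \<^item> If \<open>q\<close> is odd and \<open>r \<le> n - 2\<close>, or \<open>q > 0\<close> is even and \<open>r \<ge> 2\<close>, some inner step of
    every block is compared with an inner step of a block of opposite direction.  A stretch has to avoid these places, hence is
    short: \<open>e \<le> r + 2\<close> in the first case, \<open>e \<le> n\<close> in the second.  The extremal repetition
    is the first case with \<open>q = 1\<close>, \<open>r = n - 2\<close>.

  \<^item> In the remaining cases \<open>p\<close> differs by \<open>1\<close> from a multiple of \<open>2n\<close>.  Inner steps then agree with
    inner steps for free, but a step between blocks is compared with an inner step, which makes
    \<open>d\<close> alternate over a run of places, one for each such comparison.  Since \<open>d\<close> never
    alternates over three places, \<open>e \<le> 3n - 1\<close>, which suffices for \<open>p \<ge> 6n - 1\<close>.  For \<open>p\<close> next to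
    \<open>2n\<close> or \<open>4n\<close> a stretch of \<open>n\<close> letters would force \<open>a\<^sub>K = a\<^bsub>K+m\<^esub>\<close> with \<open>m \<in> {1, 3, 5}\<close>, so that \<open>n\<close> divides a
    sum of \<open>m\<close> signs; this leaves only \<open>n = 3\<close> and \<open>n = 5\<close>.

  For \<open>n = 2\<close> the bound is \<open>e \<le> p\<close>: the Thue--Morse word is overlap-free
  (\<open>thue_morse_overlap_free\<close>).\<close>

section \<open>Repetitions and powers\<close>

definition repeats :: "(nat \<Rightarrow> 'a) \<Rightarrow> nat \<Rightarrow> nat \<Rightarrow> nat \<Rightarrow> bool" where
  "repeats w i p e \<longleftrightarrow> (\<forall>k<e. w (i + k) = w (i + k + p))"

lemma repeatsD: "repeats w i p e \<Longrightarrow> k < e \<Longrightarrow> w (i + k) = w (i + k + p)"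
  by (simp add: repeats_def)

lemma is_power_map_repeats:
  assumes "repeats w i p e" "0 < p" "e \<le> p"
  shows "is_power (of_nat (p + e) / of_nat p) (map w [i..<i + p + e])"
proof -
  define x where "x = map w [i..<i + p]"
  define y where "y = map w [i + p..<i + p + e]"
  have "y = take e x"
    using assms by (intro nth_equalityI) (auto simp: x_def y_def repeats_def ac_simps)
  then have "prefix y x" by (simp add: take_is_prefix)
  moreover have "map w [i..<i + p + e] = concat (replicate 1 x) @ y"
    by (simp add: x_def y_def upt_add_eq_append[of i "i + p" e] flip: map_append)
  moreover have "x \<noteq> []" using assms by (simp add: x_def)
  moreover have "length x = p" "length (map w [i..<i + p + e]) = p + e" by (simp_all add: x_def)
  ultimately show ?thesis unfolding is_power_def by (metis order_refl)
qed

text \<open>A power \<open>x\<^sup>my\<close> has period \<open>\<bar>x\<bar>\<close> throughout, also across the boundary between the last full copy of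
  \<open>x\<close> and the prefix \<open>y\<close>.\<close>

lemma power_nth_period:
  assumes "prefix y x" "k + length x < length (concat (replicate m x) @ y)"
  shows "(concat (replicate m x) @ y) ! k = (concat (replicate m x) @ y) ! (k + length x)"
  using assms(2)
proof (induction m arbitrary: k)
  case 0
  with assms(1) show ?case by (auto dest: prefix_length_le)
next
  case (Suc m)
  let ?z = "concat (replicate m x) @ y"
  have z: "concat (replicate (Suc m) x) @ y = x @ ?z" by simp
  have k: "k < length ?z" using Suc.prems unfolding z by simp
  show ?case
  proof (cases "k < length x")
    case True
    have "?z ! k = x ! k"
    proof (cases m)
      case 0
      with k assms(1) show ?thesis by (auto simp: prefix_def nth_append)
    next
      case (Suc m')
      with True show ?thesis by (simp add: nth_append)
    qed
    with True show ?thesis unfolding z by (simp add: nth_append)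
  next
    case False
    then have "?z ! (k - length x) = ?z ! (k - length x + length x)"
      using k by (intro Suc.IH) simp
    with False show ?thesis unfolding z by (simp add: nth_append)
  qed
qed

lemma power_subword_repeats:
  assumes "is_power r z" "subword z w"
  obtains i p e where "0 < p" "repeats w i p e" "r = of_nat (p + e) / of_nat p"
proof -
  obtain x m y where x: "x \<noteq> []" and m: "m \<ge> 1" and y: "prefix y x"
    and z: "z = concat (replicate m x) @ y" and r: "of_nat (length z) / of_nat (length x) = r"
    using assms(1) unfolding is_power_def by (elim exE conjE)
  obtain i j where ij: "z = map w [i..<j]" using assms(2) unfolding subword_def by (elim exE)
  obtain m' where "m = Suc m'" using m by (cases m) auto
  then have le: "length x \<le> length z" unfolding z by simp
  have "repeats w i (length x) (length z - length x)"
    unfolding repeats_def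
  proof (intro allI impI)
    fix k assume "k < length z - length x"
    then have k: "k + length x < length z" by simp
    then have "z ! k = z ! (k + length x)" unfolding z by (intro power_nth_period[OF y])
    with k show "w (i + k) = w (i + k + length x)" by (simp add: ij ac_simps)
  qed
  with x le r that show ?thesis by (metis length_greater_0_conv le_add_diff_inverse)
qed

text \<open>The exponent of a stretch of \<open>e\<close> matches at distance \<open>p\<close> is \<open>(p + e) / p\<close>; the cross-multiplied
  bound keeps all later estimates within the natural numbers.\<close>

lemma critical_exponent_eqI:
  assumes bound: "\<And>i p e. 0 < p \<Longrightarrow> repeats w i p e \<Longrightarrow> e * P \<le> E * p"
    and "0 < P" "E \<le> P" "repeats w i P E"
  shows "critical_exponent w = ereal (real (P + E) / real P)"
proof -
  let ?R = "{r. \<exists>z. is_power r z \<and> subword z w}"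
  have real_r: "real_of_rat (of_nat a / of_nat b) = real a / real b" for a b
    by (simp add: of_rat_divide)
  have "ereal (of_rat r) \<le> ereal (real (P + E) / real P)" if "r \<in> ?R" for r
  proof -
    from that obtain z where "is_power r z" "subword z w" by blast
    then obtain i p e where p: "0 < p" and rep: "repeats w i p e"
      and r: "r = of_nat (p + e) / of_nat p" by (rule power_subword_repeats)
    have "(p + e) * P \<le> (P + E) * p" using bound[OF p rep] by (simp add: algebra_simps)
    then have "real (p + e) * real P \<le> real (P + E) * real p" by (metis of_nat_le_iff of_nat_mult)
    then have "real (p + e) / real p \<le> real (P + E) / real P"
      using p \<open>0 < P\<close> by (simp add: divide_simps del: of_nat_add)
    then show ?thesis unfolding r real_r by simp
  qed
  moreover have "of_nat (P + E) / of_nat P \<in> ?R"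
    using is_power_map_repeats[OF assms(4,2,3)] by (auto simp: subword_def)
  then have "ereal (of_rat (of_nat (P + E) / of_nat P)) \<le> critical_exponent w"
    unfolding critical_exponent_def by (rule SUP_upper)
  ultimately show ?thesis
    unfolding critical_exponent_def real_r by (intro antisym SUP_least)
qed

text \<open>The induction on the period.  If equality of two letters inside blocks \<open>K\<close> and \<open>K + q\<close> at the
  same offset already forces the generating letters to agree, a repetition with period \<open>n q\<close> comes
  from one with period \<open>q\<close> among the generating letters.  Every block met by the stretch contributes
  one match, whence \<open>e \<le> n E\<close>.\<close>

lemma repeats_desubstitute:
  fixes w :: "nat \<Rightarrow> 'a"
  assumes n: "n > 0" and rep: "repeats w i (n * q) e"
    and block: "\<And>K t. t < n \<Longrightarrow> w (n * K + t) = w (n * (K + q) + t) \<Longrightarrow> w K = w (K + q)"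
  obtains E where "repeats w (i div n) q E" "e \<le> n * E"
proof (cases "e = 0")
  case True
  then show ?thesis by (intro that[of 0]) (simp_all add: repeats_def)
next
  case False
  define K0 K1 where "K0 = i div n" and "K1 = (i + e - 1) div n"
  have "K0 \<le> K1" unfolding K0_def K1_def using False by (intro div_le_mono) simp
  have match: "w K = w (K + q)" if K: "K0 \<le> K" "K \<le> K1" for K
  proof -
    have nK: "n * K \<le> i + e - 1"
      using K(2) n unfolding K1_def by (simp add: less_eq_div_iff_mult_less_eq mult.commute)
    \<comment> \<open>the first position of block \<open>K\<close> that the stretch meets\<close>
    define x where "x = max i (n * K)"
    have "x div n = K"
    proof (cases "n * K \<le> i")
      case True
      then have "K \<le> K0"
        unfolding K0_def using n by (simp add: less_eq_div_iff_mult_less_eq mult.commute)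
      with K(1) True show ?thesis by (simp add: x_def K0_def)
    next
      case False
      then show ?thesis using n by (simp add: x_def)
    qed
    then have x: "x = n * K + x mod n" by (metis mult_div_mod_eq)
    have "i + (x - i) = x" "x - i < e" using nK False by (auto simp: x_def)
    with repeatsD[OF rep, of "x - i"] have "w x = w (x + n * q)" by simp
    moreover have "x + n * q = n * (K + q) + x mod n" using x by (simp add: distrib_left)
    ultimately have "w (n * K + x mod n) = w (n * (K + q) + x mod n)" using x by simp
    then show ?thesis by (rule block[rotated]) (use n in simp)
  qed
  show ?thesis
  proof (rule that[of "K1 - K0 + 1"])
    show "repeats w (i div n) q (K1 - K0 + 1)"
      unfolding repeats_def K0_def[symmetric] using match \<open>K0 \<le> K1\<close> by simp
    have "i + e - 1 < n * (K1 + 1)"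
      unfolding K1_def using n dividend_less_times_div[of n "i + e - 1"] by simp
    moreover have "n * K0 \<le> i" by (simp add: K0_def)
    moreover have "n * (K1 + 1) = n * K0 + n * (K1 - K0 + 1)"
      using \<open>K0 \<le> K1\<close> by (simp add: distrib_left[symmetric])
    ultimately show "e \<le> n * (K1 - K0 + 1)" by linarith
  qed
qed

section \<open>The Arshon words as walks with steps 1 and -1\<close>

lemma phi_snoc:
  "phi n (u @ [x]) = phi n u @ (if even (length u) then phi_e n x else phi_o n x)"
proof -
  have "map (\<lambda>i. if even i then phi_e n ((u @ [x]) ! i) else phi_o n ((u @ [x]) ! i)) [0..<length u]
      = map (\<lambda>i. if even i then phi_e n (u ! i) else phi_o n (u ! i)) [0..<length u]"
    by (rule map_cong) (auto simp: nth_append)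
  note prefix_eq = this
  show ?thesis by (simp add: phi_def prefix_eq del: map_eq_conv)
qed

lemma nth_phi:
  assumes "t < n" "k < length u"
  shows "phi n u ! (n * k + t) = (if even k then phi_e n (u ! k) else phi_o n (u ! k)) ! t"
  using assms(2)
proof (induction u rule: rev_induct)
  case (snoc x u)
  show ?case
  proof (cases "k < length u")
    case True
    then have "n * (k + 1) \<le> n * length u" by (intro mult_le_mono) auto
    with assms(1) have "n * k + t < n * length u" by simp
    with snoc.IH[OF True] True show ?thesis
      by (simp add: phi_snoc nth_append length_phi)
  next
    case False
    with snoc.prems have "k = length u" by simp
    then show ?thesis by (simp add: phi_snoc nth_append length_phi)
  qed
qed simp

lemma arshon_block:
  assumes "n \<ge> 3" "t < n"
  shows "arshon n (n * k + t) = (if even k then phi_e n (arshon n k) else phi_o n (arshon n k)) ! t"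
proof -
  define m where "m = k"
  have "k < 2 ^ k" by simp
  also have "(2 :: nat) ^ k \<le> n ^ k" using assms(1) by (intro power_mono) auto
  finally have m: "k < n ^ m" by (simp add: m_def)
  then have "n * (k + 1) \<le> n * n ^ m" by (intro mult_le_mono) auto
  then have "n * k + t < n ^ Suc m" using assms(2) by simp
  from arshon_eq_nth[OF assms(1) this] arshon_eq_nth[OF assms(1) m] show ?thesis
    using nth_phi[of t n k "(phi n ^^ m) [0]"] m assms by (simp add: length_phi_iterate)
qed

lemma arshon_block_even:
  assumes "n \<ge> 3" "t < n" "even k"
  shows "[int (arshon n (n * k + t)) = int (arshon n k) + int t] (mod int n)"
  using assms by (simp add: arshon_block phi_e_def cong_def zmod_int)

lemma arshon_block_odd:
  assumes "n \<ge> 3" "t < n" "odd k"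
  shows "[int (arshon n (n * k + t)) = int (arshon n k) - 1 - int t] (mod int n)"
  using assms phi_o_eq_int[of t n "arshon n k"] by (simp add: arshon_block cong_def)

lemma arshon_less:
  assumes "n \<ge> 3"
  shows "arshon n i < n"
  using assms arshon_block[OF assms, of "i mod n" "i div n"]
  by (simp add: phi_e_def phi_o_def)

lemma arshon_eq_iff_cong:
  assumes "n \<ge> 3"
  shows "arshon n i = arshon n j \<longleftrightarrow> [int (arshon n i) = int (arshon n j)] (mod int n)"
  using arshon_less[OF assms, of i] arshon_less[OF assms, of j] by (simp add: cong_def)

lemma arshon_block_distinct:
  assumes "n \<ge> 3" "t < n" "t' < n" "arshon n (n * k + t) = arshon n (n * k + t')"
  shows "t = t'"
proof (cases "even k")
  case True
  have "[int (arshon n k) + int t = int (arshon n k) + int t'] (mod int n)"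
    using arshon_block_even[OF assms(1,2) True] arshon_block_even[OF assms(1,3) True] assms(4)
    by (metis cong_sym cong_trans)
  then have "[int t = int t'] (mod int n)" by (simp add: cong_iff_dvd_diff)
  then show ?thesis using assms by (simp add: cong_int_iff cong_def)
next
  case False
  have "[int (arshon n k) - 1 - int t = int (arshon n k) - 1 - int t'] (mod int n)"
    using arshon_block_odd[OF assms(1,2) False] arshon_block_odd[OF assms(1,3) False] assms(4)
    by (metis cong_sym cong_trans)
  then have "[int t' = int t] (mod int n)" by (simp add: cong_iff_dvd_diff)
  then show ?thesis using assms by (simp add: cong_int_iff cong_def)
qed

text \<open>The claimed difference between the letters at positions \<open>i + 1\<close> and \<open>i\<close>.  The guard \<open>n \<ge> 2\<close> makes
  the recursion terminate: for \<open>n \<le> 1\<close> position \<open>0\<close> would call itself.\<close>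

function arshon_step :: "nat \<Rightarrow> nat \<Rightarrow> int" where
  "arshon_step n i =
    (if n \<ge> 2 \<and> i mod n = n - 1 then arshon_step n (i div n) else (- 1) ^ (i div n))"
  by auto
termination
proof (relation "measure snd")
  fix n i :: nat
  assume n: "2 \<le> n \<and> i mod n = n - 1"
  then have "i > 0" by (cases i) auto
  with n show "((n, i div n), (n, i)) \<in> measure snd" by simp
qed simp

declare arshon_step.simps[simp del]

lemma arshon_step_inside:
  assumes "t < n - 1"
  shows "arshon_step n (n * k + t) = (- 1) ^ k"
  using assms by (subst arshon_step.simps) (simp add: div_add1_eq)

lemma arshon_step_between:
  assumes "n \<ge> 2"
  shows "arshon_step n (n * k + (n - 1)) = arshon_step n k"
proof -
  have "n - 1 < n" using assms by simp
  then have "(n * k + (n - 1)) mod n = n - 1" "(n * k + (n - 1)) div n = k"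
    by (metis mod_mult_self4 mod_less, metis assms add.right_neutral div_less
        div_mult_self4 not_numeral_le_zero)
  with assms show ?thesis by (subst arshon_step.simps) simp
qed

lemma arshon_step_cases: "arshon_step n i = 1 \<or> arshon_step n i = - 1"
proof (induction n i rule: arshon_step.induct)
  case (1 n i)
  then show ?case by (subst (1 2) arshon_step.simps) (auto simp: minus_one_power_iff)
qed

text \<open>Inside a block this is the definition of the two substitutions.  At the end of block \<open>k\<close>, the two
  letters are \<open>a\<^sub>k - 1\<close> and \<open>a\<^bsub>k+1\<^esub> - 1\<close> for even \<open>k\<close>, and \<open>a\<^sub>k\<close> and \<open>a\<^bsub>k+1\<^esub>\<close> for odd \<open>k\<close>; either way they
  differ by \<open>a\<^bsub>k+1\<^esub> - a\<^sub>k\<close>, so that the step is inherited from position \<open>k\<close>.\<close>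

lemma arshon_Suc:
  assumes n: "n \<ge> 3"
  shows "[int (arshon n (Suc i)) = int (arshon n i) + arshon_step n i] (mod int n)"
proof (induction i rule: less_induct)
  case (less i)
  define k t where "k = i div n" and "t = i mod n"
  have i: "i = n * k + t" and t: "t < n" using n by (auto simp: k_def t_def)
  show ?case
  proof (cases "t < n - 1")
    case True
    then have t': "t + 1 < n" by simp
    show ?thesis
    proof (cases "even k")
      case even: True
      have "int n dvd int (arshon n (Suc i)) - (int (arshon n k) + int (t + 1))"
        using arshon_block_even[OF n t' even] by (simp add: i cong_iff_dvd_diff)
      moreover have "int n dvd int (arshon n i) - (int (arshon n k) + int t)"
        using arshon_block_even[OF n t even] by (simp add: i cong_iff_dvd_diff)
      ultimately have "int n dvd (int (arshon n (Suc i)) - (int (arshon n k) + int (t + 1)))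
          - (int (arshon n i) - (int (arshon n k) + int t))"
        by (rule dvd_diff)
      then show ?thesis
        using arshon_step_inside[OF True, of k] even
        by (simp add: i cong_iff_dvd_diff algebra_simps)
    next
      case odd: False
      have "int n dvd int (arshon n (Suc i)) - (int (arshon n k) - 1 - int (t + 1))"
        using arshon_block_odd[OF n t' odd] by (simp add: i cong_iff_dvd_diff)
      moreover have "int n dvd int (arshon n i) - (int (arshon n k) - 1 - int t)"
        using arshon_block_odd[OF n t odd] by (simp add: i cong_iff_dvd_diff)
      ultimately have "int n dvd (int (arshon n (Suc i)) - (int (arshon n k) - 1 - int (t + 1)))
          - (int (arshon n i) - (int (arshon n k) - 1 - int t))"
        by (rule dvd_diff)
      then show ?thesis
        using arshon_step_inside[OF True, of k] odd
        by (simp add: i cong_iff_dvd_diff algebra_simps)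
    qed
  next
    case False
    with t have t_eq: "t = n - 1" by simp
    then have i': "Suc i = n * Suc k + 0" using i n by simp
    have "1 * k \<le> n * k" using n by (intro mult_le_mono1) simp
    then have "k < i" using n t_eq i by linarith
    note IH = less.IH[OF this]
    have step: "arshon_step n i = arshon_step n k" unfolding i t_eq using n by (intro arshon_step_between) simp
    have n0: "0 < n" using n by simp
    show ?thesis
    proof (cases "even k")
      case even: True
      then have odd: "odd (Suc k)" by simp
      have d1: "int n dvd (int (arshon n (Suc i)) - (int (arshon n (Suc k)) - 1))"
        using arshon_block_odd[OF n n0 odd] unfolding i' by (simp add: cong_iff_dvd_diff)
      have d2: "int n dvd (int (arshon n i) - (int (arshon n k) + int t))"
        using arshon_block_even[OF n t even] unfolding i by (simp add: cong_iff_dvd_diff)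
      have d3: "int n dvd (int (arshon n (Suc k)) - (int (arshon n k) + arshon_step n k))"
        using IH by (simp add: cong_iff_dvd_diff)
      have "int n dvd (int (arshon n (Suc i)) - (int (arshon n (Suc k)) - 1))
          - (int (arshon n i) - (int (arshon n k) + int t))
          + (int (arshon n (Suc k)) - (int (arshon n k) + arshon_step n k)) - int n"
        by (rule dvd_diff[OF dvd_add[OF dvd_diff[OF d1 d2] d3] dvd_refl])
      also have "\<dots> = int (arshon n (Suc i)) - (int (arshon n i) + arshon_step n k)"
        using t_eq n by (simp add: of_nat_diff)
      finally show ?thesis unfolding step by (simp add: cong_iff_dvd_diff)
    next
      case odd: False
      then have even: "even (Suc k)" by simp
      have d1: "int n dvd (int (arshon n (Suc i)) - int (arshon n (Suc k)))"
        using arshon_block_even[OF n n0 even] unfolding i' by (simp add: cong_iff_dvd_diff)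
      have d2: "int n dvd (int (arshon n i) - (int (arshon n k) - 1 - int t))"
        using arshon_block_odd[OF n t odd] unfolding i by (simp add: cong_iff_dvd_diff)
      have d3: "int n dvd (int (arshon n (Suc k)) - (int (arshon n k) + arshon_step n k))"
        using IH by (simp add: cong_iff_dvd_diff)
      have "int n dvd (int (arshon n (Suc i)) - int (arshon n (Suc k)))
          - (int (arshon n i) - (int (arshon n k) - 1 - int t))
          + (int (arshon n (Suc k)) - (int (arshon n k) + arshon_step n k)) + int n"
        by (rule dvd_add[OF dvd_add[OF dvd_diff[OF d1 d2] d3] dvd_refl])
      also have "\<dots> = int (arshon n (Suc i)) - (int (arshon n i) + arshon_step n k)"
        using t_eq n by (simp add: of_nat_diff)
      finally show ?thesis unfolding step by (simp add: cong_iff_dvd_diff)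
    qed
  qed
qed

lemma arshon_Suc_neq:
  assumes "n \<ge> 3"
  shows "arshon n (Suc i) \<noteq> arshon n i"
proof
  assume "arshon n (Suc i) = arshon n i"
  with arshon_Suc[OF assms, of i] have "int n dvd arshon_step n i"
    by (simp add: cong_iff_dvd_diff)
  with arshon_step_cases[of n i] assms show False by auto
qed

text \<open>Two steps are determined by their residues, because \<open>1\<close> and \<open>-1\<close> are distinct modulo \<open>n \<ge> 3\<close>.\<close>

lemma arshon_step_match:
  assumes n: "n \<ge> 3"
    and "arshon n i = arshon n j" "arshon n (Suc i) = arshon n (Suc j)"
  shows "arshon_step n i = arshon_step n j"
proof -
  have "[int (arshon n i) + arshon_step n i = int (arshon n i) + arshon_step n j] (mod int n)"
    using arshon_Suc[OF n, of i] arshon_Suc[OF n, of j] assms by (metis cong_sym cong_trans)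
  then have dvd: "int n dvd arshon_step n i - arshon_step n j" by (simp add: cong_iff_dvd_diff)
  have "\<not> int n dvd 2" using n zdvd_imp_le[of "int n" 2] by auto
  moreover then have "\<not> int n dvd - 2" by simp
  ultimately show ?thesis
    using dvd arshon_step_cases[of n i] arshon_step_cases[of n j] by auto
qed

text \<open>Among three consecutive steps, either two neighbours lie inside one block, or the middle one sits
  between two blocks; these have opposite directions, and the middle step agrees with one of them.\<close>

lemma arshon_step_not_alternating:
  assumes n: "n \<ge> 3"
    and "arshon_step n i \<noteq> arshon_step n (i + 1)"
  shows "arshon_step n (i + 1) = arshon_step n (i + 2)"
proof -
  define k t where "k = i div n" and "t = i mod n"
  have i: "i = n * k + t" and t: "t < n" using n by (auto simp: k_def t_def)
  consider "t + 1 < n - 1" | "t + 1 = n - 1" | "t = n - 1" using t by linarith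
  then show ?thesis
  proof cases
    case 1
    then have "arshon_step n i = arshon_step n (i + 1)"
      using arshon_step_inside[of t n k] arshon_step_inside[of "t + 1" n k] i by simp
    with assms show ?thesis by simp
  next
    case 2
    then have i2: "i + 2 = n * (k + 1) + 0" using i n by simp
    have "arshon_step n (i + 2) = - ((- 1) ^ k)"
      unfolding i2 using arshon_step_inside[of 0 n "k + 1"] n by simp
    moreover have "arshon_step n i = (- 1) ^ k"
      using arshon_step_inside[of t n k] 2 i by simp
    ultimately have "arshon_step n (i + 2) = - arshon_step n i" by simp
    with assms arshon_step_cases[of n i] arshon_step_cases[of n "i + 1"] show ?thesis by auto
  next
    case 3
    then have "i + 1 = n * (k + 1) + 0" "i + 2 = n * (k + 1) + 1" using i n by simp_all
    then show ?thesis
      using arshon_step_inside[of 0 n "k + 1"] arshon_step_inside[of 1 n "k + 1"] n by simp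
  qed
qed

section \<open>Repetitions in Arshon words of order at least 3\<close>

lemma repeats_arshon_step:
  assumes "n \<ge> 3" "repeats (arshon n) i p e" "k + 1 < e"
  shows "arshon_step n (i + k) = arshon_step n (i + k + p)"
  using arshon_step_match[OF assms(1), of "i + k" "i + k + p"]
    repeatsD[OF assms(2), of k] repeatsD[OF assms(2), of "k + 1"] assms(3) by simp

text \<open>Any \<open>n\<close> consecutive positions contain one with a prescribed offset in its block.\<close>

lemma offset_hit:
  fixes n :: nat
  assumes "t < n"
  obtains k K where "k < n" "i + k = n * K + t"
proof (cases "i mod n \<le> t")
  case True
  have "i + (t - i mod n) = n * (i div n) + t"
    using True mult_div_mod_eq[of n i] by linarith
  with assms show ?thesis by (intro that[of "t - i mod n"]) auto
next
  case False
  have "i mod n < n" using assms by simp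
  then have "i + (n + t - i mod n) = n * (i div n + 1) + t"
    using False mult_div_mod_eq[of n i] by (simp only: distrib_left mult_1_right)
  with assms False show ?thesis by (intro that[of "n + t - i mod n" "i div n + 1"]) auto
qed

lemma arshon_add:
  assumes "n \<ge> 3"
  shows "[int (arshon n (i + m)) = int (arshon n i) + (\<Sum>j<m. arshon_step n (i + j))] (mod int n)"
proof (induction m)
  case (Suc m)
  have "[int (arshon n (i + m)) + arshon_step n (i + m)
      = int (arshon n i) + (\<Sum>j<m. arshon_step n (i + j)) + arshon_step n (i + m)] (mod int n)"
    by (rule cong_add[OF Suc.IH cong_refl])
  with arshon_Suc[OF assms, of "i + m"] show ?case
    by (auto simp: add.assoc intro: cong_trans)
qed simp

lemma arshon_eq_imp_dvd_steps:
  assumes "n \<ge> 3" "arshon n i = arshon n (i + m)"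
  shows "int n dvd (\<Sum>j<m. arshon_step n (i + j))"
  using arshon_add[OF assms(1), of i m] assms(2) by (simp add: cong_iff_dvd_diff)

lemma dvd_1_3_5:
  fixes n :: nat
  assumes "n \<ge> 3"
  shows "\<not> int n dvd 1" "int n dvd 3 \<Longrightarrow> n = 3" "int n dvd 5 \<Longrightarrow> n = 5"
proof -
  show "\<not> int n dvd 1" using assms by auto
  show "n = 3" if "int n dvd 3" using zdvd_imp_le[OF that] assms by simp
  assume n: "int n dvd 5"
  then have "n \<le> 5" using zdvd_imp_le[OF n] by simp
  with assms consider "n = 3" | "n = 4" | "n = 5" by linarith
  then show "n = 5" by cases (use n in simp_all)
qed

text \<open>A sum of three signs is \<open>1\<close>, \<open>-1\<close>, \<open>3\<close> or \<open>-3\<close>, and only the last two can be multiples of \<open>n \<ge> 3\<close>.\<close>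

lemma arshon_eq_distance_3:
  assumes "n \<ge> 3" "arshon n i = arshon n (i + 3)"
  shows "n = 3 \<and> arshon_step n (i + 1) = arshon_step n i \<and> arshon_step n (i + 2) = arshon_step n i"
proof -
  have "int n dvd arshon_step n i + arshon_step n (i + 1) + arshon_step n (i + 2)"
    using arshon_eq_imp_dvd_steps[OF assms] by (simp add: eval_nat_numeral)
  then show ?thesis
    using arshon_step_cases[of n i] arshon_step_cases[of n "i + 1"]
      arshon_step_cases[of n "i + 2"] dvd_1_3_5[OF assms(1)]
    by (elim disjE) (simp_all del: int_dvd_int_iff)
qed

text \<open>For \<open>n = 5\<close> a sum of five signs is a multiple of \<open>n\<close> only if all five agree.\<close>

lemma arshon_eq_distance_5:
  assumes "n \<ge> 3" "arshon n i = arshon n (i + 5)"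
  shows "n = 3 \<or> n = 5 \<and> arshon_step n (i + 1) = arshon_step n i"
proof -
  have "int n dvd arshon_step n i + arshon_step n (i + 1) + arshon_step n (i + 2)
      + arshon_step n (i + 3) + arshon_step n (i + 4)"
    using arshon_eq_imp_dvd_steps[OF assms] by (simp add: eval_nat_numeral)
  then show ?thesis
    using arshon_step_cases[of n i] arshon_step_cases[of n "i + 1"]
      arshon_step_cases[of n "i + 2"] arshon_step_cases[of n "i + 3"]
      arshon_step_cases[of n "i + 4"] dvd_1_3_5[OF assms(1)]
    by (elim disjE) (simp_all del: int_dvd_int_iff)
qed

lemma bound_mono:
  fixes e :: nat
  assumes "e \<le> E" "P \<le> p" "E * (2 * n - 2) \<le> n * P"
  shows "e * (2 * n - 2) \<le> n * p"
proof -
  have "e * (2 * n - 2) \<le> E * (2 * n - 2)" using assms(1) by (rule mult_le_mono1)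
  also have "\<dots> \<le> n * P" by (rule assms(3))
  also have "\<dots> \<le> n * p" using assms(2) by (rule mult_le_mono2)
  finally show ?thesis .
qed

subsection \<open>Periods below n\<close>

text \<open>With two matches in a row, either two letters of one block coincide, or an inner step of a block
  is compared with an inner step of the next block, which has the opposite direction.\<close>

lemma repeats_bound_short:
  assumes n: "n \<ge> 3" and p: "0 < p" "p < n" and rep: "repeats (arshon n) i p e"
  shows "e * (2 * n - 2) \<le> n * p"
proof -
  have "e \<le> 1"
  proof (rule ccontr)
    assume "\<not> e \<le> 1"
    then have e: "0 + 1 < e" by simp
    define K t where "K = i div n" and "t = i mod n"
    have i: "i = n * K + t" and t: "t < n" using n by (auto simp: K_def t_def)
    consider "t = n - 1" | "t + p < n" | "t < n - 1" "t + p \<ge> n" using t by linarith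
    then show False
    proof cases
      case 1
      then have i1: "i + 1 = n * (K + 1) + 0" using i n by simp
      have "arshon n (n * (K + 1) + 0) = arshon n (n * (K + 1) + p)"
        using repeatsD[OF rep, of 1] e unfolding i1 by simp
      then have "0 = p" by (rule arshon_block_distinct[OF n, rotated 2]) (use n p in auto)
      with p show False by simp
    next
      case 2
      have "arshon n (n * K + t) = arshon n (n * K + (t + p))"
        using repeatsD[OF rep, of 0] e i by (simp add: add.assoc)
      then have "t = t + p" by (rule arshon_block_distinct[OF n t 2])
      with p show False by simp
    next
      case 3
      then have ip: "i + 0 + p = n * (K + 1) + (t + p - n)" using i by simp
      have "arshon_step n (n * K + t) = arshon_step n (n * (K + 1) + (t + p - n))"
        using repeats_arshon_step[OF n rep e] unfolding ip i[symmetric] by simp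
      moreover have "t + p - n < n - 1" using 3 p by linarith
      ultimately show False
        using arshon_step_inside[of t n K] arshon_step_inside[of "t + p - n" n "K + 1"] 3 by simp
    qed
  qed
  moreover have "e = 0" if "p = 1"
    using repeatsD[OF rep, of 0] arshon_Suc_neq[OF n, of i] that by (cases e) auto
  ultimately consider "e = 0" | "e \<le> 1" "2 \<le> p" using p by linarith
  then show ?thesis
  proof cases
    case 2
    then show ?thesis by (rule bound_mono) simp
  qed simp
qed

subsection \<open>Periods whose block shift has the wrong parity\<close>

text \<open>For an offset \<open>u\<close> with \<open>u + r < n - 1\<close>, the inner step at \<open>u\<close> of block \<open>K\<close> is compared with an inner
  step of block \<open>K + q\<close>, which has the opposite direction.  The steps of a stretch avoid these
  \<open>n - 1 - r\<close> offsets, so it contains at most \<open>r + 1\<close> steps.\<close>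

lemma repeats_bound_odd_shift:
  assumes n: "n \<ge> 3" and odd: "odd q" and r: "r \<le> n - 2"
    and rep: "repeats (arshon n) i (n * q + r) e"
  shows "e * (2 * n - 2) \<le> n * (n * q + r)"
proof -
  have "e \<le> r + 2"
  proof (rule ccontr)
    assume "\<not> e \<le> r + 2"
    then have e: "r + 3 \<le> e" by simp
    \<comment> \<open>the start of the stretch if its offset is already small, otherwise the start of the next block\<close>
    obtain k K u where k: "k \<le> r + 1" and u: "u + r < n - 1" and pos: "i + k = n * K + u"
    proof (cases "i mod n + r < n - 1")
      case True
      then show ?thesis by (intro that[of 0 "i mod n" "i div n"]) auto
    next
      case False
      have lt: "i mod n < n" using n by simp
      then have "i + (n - i mod n) = n * (i div n + 1) + 0"
        using lt mult_div_mod_eq[of n i] by (simp only: distrib_left mult_1_right)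
      with False r n lt show ?thesis by (intro that[of "n - i mod n" 0 "i div n + 1"]) auto
    qed
    have pos': "i + k + (n * q + r) = n * (K + q) + (u + r)"
      unfolding pos by (simp add: distrib_left)
    have "arshon_step n (n * K + u) = arshon_step n (n * (K + q) + (u + r))"
      using repeats_arshon_step[OF n rep, of k] k e unfolding pos' unfolding pos by simp
    then show False
      using arshon_step_inside[of u n K] arshon_step_inside[OF u, of "K + q"] u odd
      by (simp add: power_add)
  qed
  \<comment> \<open>the worst case is \<open>q = 1\<close>; there \<open>(r + 2) (2 n - 2) \<le> n (n + r)\<close> amounts to \<open>r \<le> n - 2\<close>\<close>
  moreover have "n * 1 + r \<le> n * q + r"
    using odd by (intro add_le_mono1 mult_le_mono2) (auto elim: oddE)
  moreover have "(r + 2) * (2 * n - 2) \<le> n * (n * 1 + r)"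
  proof -
    have "r + 2 \<le> n" using r n by linarith
    then obtain l where "n = r + 2 + l" by (auto dest: le_Suc_ex)
    then show ?thesis by (simp add: algebra_simps)
  qed
  ultimately show ?thesis by (rule bound_mono)
qed

text \<open>The last inner step of block \<open>K\<close> is compared with an inner step of block \<open>K + q + 1\<close>, which has the
  opposite direction; a stretch of more than \<open>n\<close> letters cannot avoid such a place.\<close>

lemma repeats_bound_even_shift:
  assumes n: "n \<ge> 3" and even: "even q" "q > 0" and r: "2 \<le> r" "r < n"
    and rep: "repeats (arshon n) i (n * q + r) e"
  shows "e * (2 * n - 2) \<le> n * (n * q + r)"
proof -
  have "e \<le> n"
  proof (rule ccontr)
    assume "\<not> e \<le> n"
    then have e: "n < e" by simp
    obtain k K where k: "k < n" and pos: "i + k = n * K + (n - 2)"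
      using offset_hit[of "n - 2" n i] n by auto
    have pos': "i + k + (n * q + r) = n * (K + q + 1) + (r - 2)"
      unfolding pos using n r by (simp add: distrib_left)
    have "arshon_step n (n * K + (n - 2)) = arshon_step n (n * (K + q + 1) + (r - 2))"
      using repeats_arshon_step[OF n rep, of k] k e unfolding pos' unfolding pos by simp
    moreover have "r - 2 < n - 1" using r by linarith
    ultimately show False
      using arshon_step_inside[of "n - 2" n K] arshon_step_inside[of "r - 2" n "K + q + 1"]
        even r n by (simp add: power_add)
  qed
  moreover have "n * 2 \<le> n * q + r"
    using even by (intro trans_le_add1 mult_le_mono2) (auto elim: evenE)
  moreover have "n * (2 * n - 2) \<le> n * (n * 2)" by (intro mult_le_mono2) simp
  ultimately show ?thesis by (rule bound_mono)
qed

subsection \<open>Periods next to a multiple of 2n\<close>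

text \<open>Three consecutive steps cannot follow an alternating pattern; the factor \<open>c\<close> covers both patterns,
  and the index \<open>M\<close> of the blocks may differ from the index \<open>K\<close> of the steps by the shift \<open>q\<close>.\<close>

lemma sign_alternation_at_most_twice:
  assumes "n \<ge> 3" "c \<noteq> 0"
    and "arshon_step n K = c * (- 1) ^ M" "arshon_step n (K + 1) = c * (- 1) ^ (M + 1)"
  shows "arshon_step n (K + 2) \<noteq> c * (- 1) ^ (M + 2)"
proof -
  have "arshon_step n K \<noteq> arshon_step n (K + 1)" using assms by simp
  from arshon_step_not_alternating[OF assms(1) this] assms show ?thesis by simp
qed

text \<open>For \<open>p = n q + 1\<close> with even \<open>q\<close>, blocks \<open>K\<close> and \<open>K + q\<close> have the same direction, and the comparison is
  displaced by one letter.  Only two offsets carry information: the last inner step of block \<open>K\<close>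
  is compared with the step after block \<open>K + q\<close>, and the step after block \<open>K\<close> with the first inner step
  of block \<open>K + q + 1\<close>.\<close>

locale shift_by_one =
  fixes n q i e :: nat
  assumes n: "n \<ge> 3" and q: "even q" "q > 0"
    and rep: "repeats (arshon n) i (n * q + 1) e"
begin

lemma step_last:
  assumes "k + 1 < e" "i + k = n * K + (n - 1)"
  shows "arshon_step n K = - ((- 1) ^ K)"
proof -
  have "i + k + (n * q + 1) = n * (K + q + 1) + 0" using n assms(2) by (simp add: distrib_left)
  with repeats_arshon_step[OF n rep assms(1)] assms(2)
  have "arshon_step n (n * K + (n - 1)) = arshon_step n (n * (K + q + 1) + 0)" by simp
  then show ?thesis
    using arshon_step_between[of n K] arshon_step_inside[of 0 n "K + q + 1"] n q
    by (simp add: power_add)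
qed

lemma step_last_but_one:
  assumes "k + 1 < e" "i + k = n * K + (n - 2)"
  shows "arshon_step n (K + q) = (- 1) ^ K"
proof -
  have "i + k + (n * q + 1) = n * (K + q) + (n - 1)" using n assms(2) by (simp add: distrib_left)
  with repeats_arshon_step[OF n rep assms(1)] assms(2)
  have "arshon_step n (n * K + (n - 2)) = arshon_step n (n * (K + q) + (n - 1))" by simp
  then show ?thesis
    using arshon_step_between[of n "K + q"] arshon_step_inside[of "n - 2" n K] n by simp
qed

lemma letter_last:
  assumes "k < e" "i + k = n * K + (n - 1)"
  shows "arshon n K = arshon n (K + q + 1)"
proof -
  have "i + k + (n * q + 1) = n * (K + q + 1) + 0" using n assms(2) by (simp add: distrib_left)
  with repeatsD[OF rep assms(1)] assms(2)
  have eq: "arshon n (n * K + (n - 1)) = arshon n (n * (K + q + 1) + 0)" by simp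
  have lt: "n - 1 < n" "0 < n" using n by auto
  have "[int (arshon n K) = int (arshon n (K + q + 1))] (mod int n)"
  proof (cases "even K")
    case True
    then have odd: "odd (K + q + 1)" using q by simp
    have "[int (arshon n K) + int (n - 1) = int (arshon n (K + q + 1)) - 1 - int 0] (mod int n)"
      using arshon_block_even[OF n lt(1) True] arshon_block_odd[OF n lt(2) odd] eq
      by (metis cong_sym cong_trans)
    then have "int n dvd int (arshon n K) + int (n - 1) - (int (arshon n (K + q + 1)) - 1 - int 0) - int n"
      by (simp only: cong_iff_dvd_diff dvd_diff dvd_refl)
    then show ?thesis using n by (simp add: cong_iff_dvd_diff of_nat_diff)
  next
    case False
    then have even: "even (K + q + 1)" using q by simp
    have "[int (arshon n K) - 1 - int (n - 1) = int (arshon n (K + q + 1)) + int 0] (mod int n)"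
      using arshon_block_odd[OF n lt(1) False] arshon_block_even[OF n lt(2) even] eq
      by (metis cong_sym cong_trans)
    then have "int n dvd int (arshon n K) - 1 - int (n - 1) - (int (arshon n (K + q + 1)) + int 0) + int n"
      by (simp only: cong_iff_dvd_diff dvd_add dvd_refl)
    then show ?thesis using n by (simp add: cong_iff_dvd_diff of_nat_diff)
  qed
  then show ?thesis by (simp only: arshon_eq_iff_cong[OF n])
qed

text \<open>A longer stretch has at least \<open>3n - 1\<close> step comparisons.  If it starts with a block, these cover the
  last inner steps of three blocks; otherwise they cover the ends of three blocks.  Both give
  three alternating steps.\<close>

lemma length_le: "e \<le> 3 * n - 1"
proof (rule ccontr)
  assume "\<not> e \<le> 3 * n - 1"
  then have e: "3 * n \<le> e" by simp
  define K t where "K = i div n" and "t = i mod n"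
  have i: "i = n * K + t" and t: "t < n" using n by (auto simp: K_def t_def)
  show False
  proof (cases "t = 0")
    case True
    have "arshon_step n (K + q) = 1 * (- 1) ^ K"
      using step_last_but_one[of "n - 2" K] e n i True by simp
    moreover have "arshon_step n (K + q + 1) = 1 * (- 1) ^ (K + 1)"
      using step_last_but_one[of "n - 2 + n" "K + 1"] e n i True by (simp add: distrib_left ac_simps)
    moreover have "arshon_step n (K + q + 2) = 1 * (- 1) ^ (K + 2)"
      using step_last_but_one[of "n - 2 + 2 * n" "K + 2"] e n i True
      by (simp add: distrib_left ac_simps)
    ultimately show False using sign_alternation_at_most_twice[OF n, of 1 "K + q" K] by simp
  next
    case False
    have "arshon_step n K = - 1 * (- 1) ^ K"
      using step_last[of "n - 1 - t" K] e n i t False by simp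
    moreover have "arshon_step n (K + 1) = - 1 * (- 1) ^ (K + 1)"
      using step_last[of "n - 1 - t + n" "K + 1"] e n i t False by (simp add: distrib_left)
    moreover have "arshon_step n (K + 2) = - 1 * (- 1) ^ (K + 2)"
      using step_last[of "n - 1 - t + 2 * n" "K + 2"] e n i t False by (simp add: distrib_left)
    ultimately show False using sign_alternation_at_most_twice[OF n, of "- 1" K K] by simp
  qed
qed

text \<open>A stretch of \<open>n\<close> letters meets the end of some block \<open>K\<close>, and then \<open>a\<^sub>K = a\<^bsub>K+3\<^esub>\<close>.  This is possible
  for \<open>n = 3\<close> only, with three equal steps from \<open>K\<close> on.  Six matches then also cover the end of block
  \<open>K + 1\<close> or the last inner step of block \<open>K\<close>, each of which demands a change of direction.\<close>

lemma length_shift_2: "q = 2 \<Longrightarrow> e \<le> n - 1 \<or> n = 3 \<and> e \<le> 5"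
proof (rule ccontr)
  assume q2: "q = 2" and neg: "\<not> (e \<le> n - 1 \<or> n = 3 \<and> e \<le> 5)"
  obtain k K where k: "k < n" and pos: "i + k = n * K + (n - 1)"
    using offset_hit[of "n - 1" n i] n by auto
  have "k < e" using k neg n by linarith
  from letter_last[OF this pos] have "arshon n K = arshon n (K + 3)" using q2 by (simp add: numeral_eq_Suc)
  from arshon_eq_distance_3[OF n this]
  have n3: "n = 3" and eq: "arshon_step n (K + 1) = arshon_step n K"
    "arshon_step n (K + 2) = arshon_step n K" by auto
  have e: "6 \<le> e" using neg n3 by simp
  have last: "arshon_step n K = - ((- 1) ^ K)" using step_last[OF _ pos] k n3 e by simp
  show False
  proof (cases "k = 0")
    case True
    then have "arshon_step n (K + 1) = - ((- 1) ^ (K + 1))"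
      using step_last[of 3 "K + 1"] pos n3 e by simp
    with eq last show False by simp
  next
    case False
    then have "arshon_step n (K + 2) = (- 1) ^ K"
      using step_last_but_one[of "k - 1" K] pos n3 e k q2 by simp
    with eq last show False by simp
  qed
qed

text \<open>Here the end of block \<open>K\<close> gives \<open>a\<^sub>K = a\<^bsub>K+5\<^esub>\<close>.  For \<open>n = 5\<close> this makes the steps at \<open>K\<close> and \<open>K + 1\<close>
  agree, while a stretch that covers the ends of blocks \<open>K\<close> and \<open>K + 1\<close> makes them differ.\<close>

lemma length_shift_4: "q = 4 \<Longrightarrow> e \<le> 2 * n \<or> n = 3"
proof (rule ccontr)
  assume q4: "q = 4" and neg: "\<not> (e \<le> 2 * n \<or> n = 3)"
  obtain k K where k: "k < n" and pos: "i + k = n * K + (n - 1)"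
    using offset_hit[of "n - 1" n i] n by auto
  have "k < e" using k neg by linarith
  from letter_last[OF this pos] have "arshon n K = arshon n (K + 5)" using q4 by (simp add: numeral_eq_Suc)
  from arshon_eq_distance_5[OF n this] neg
  have eq: "arshon_step n (K + 1) = arshon_step n K" by blast
  have "arshon_step n K = - ((- 1) ^ K)" using step_last[OF _ pos] k neg by simp
  moreover have "arshon_step n (K + 1) = - ((- 1) ^ (K + 1))"
    using step_last[of "k + n" "K + 1"] k pos neg by (simp add: distrib_left)
  ultimately show False using eq by simp
qed

lemma bound: "e * (2 * n - 2) \<le> n * (n * q + 1)"
proof -
  obtain m where m: "n = m + 3" using n le_Suc_ex[of 3 n] by (auto simp: ac_simps)
  consider "q = 2" | "q = 4" | "6 \<le> q" using q by (auto elim!: evenE) linarith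
  then show ?thesis
  proof cases
    case 1
    from length_shift_2[OF this] show ?thesis
    proof
      assume "e \<le> n - 1"
      then show ?thesis by (rule bound_mono[OF _ order_refl]) (simp add: 1 m algebra_simps)
    next
      assume "n = 3 \<and> e \<le> 5"
      then show ?thesis using 1 by simp
    qed
  next
    case 2
    from length_shift_4[OF this] show ?thesis
    proof
      assume "e \<le> 2 * n"
      then show ?thesis by (rule bound_mono[OF _ order_refl]) (simp add: 2 m algebra_simps)
    next
      assume "n = 3"
      then show ?thesis using 2 length_le by simp
    qed
  next
    case 3
    then have "n * 6 + 1 \<le> n * q + 1" by simp
    then show ?thesis by (rule bound_mono[OF length_le]) (simp add: m algebra_simps)
  qed
qed

end

text \<open>The period \<open>n q + (n - 1)\<close> with odd \<open>q\<close> is \<open>n (q + 1) - 1\<close>: the mirror image of the previous case,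
  with the displacement in the other direction.  Informative are now the first inner step of
  block \<open>K\<close>, compared with the step after block \<open>K + q\<close>, and again the step after block \<open>K\<close>.\<close>

locale shift_by_minus_one =
  fixes n q i e :: nat
  assumes n: "n \<ge> 3" and q: "odd q"
    and rep: "repeats (arshon n) i (n * q + (n - 1)) e"
begin

lemma step_last:
  assumes "k + 1 < e" "i + k = n * K + (n - 1)"
  shows "arshon_step n K = (- 1) ^ K"
proof -
  have "i + k + (n * q + (n - 1)) = n * (K + q + 1) + (n - 2)"
    using n assms(2) by (simp add: distrib_left)
  with repeats_arshon_step[OF n rep assms(1)] assms(2)
  have "arshon_step n (n * K + (n - 1)) = arshon_step n (n * (K + q + 1) + (n - 2))" by simp
  then show ?thesis
    using arshon_step_between[of n K] arshon_step_inside[of "n - 2" n "K + q + 1"] n q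
    by (simp add: power_add)
qed

lemma step_first:
  assumes "k + 1 < e" "i + k = n * K"
  shows "arshon_step n (K + q) = (- 1) ^ K"
proof -
  have pos: "i + k + (n * q + (n - 1)) = n * (K + q) + (n - 1)"
    using assms(2) by (simp add: distrib_left)
  have "arshon_step n (n * K) = arshon_step n (n * (K + q) + (n - 1))"
    using repeats_arshon_step[OF n rep assms(1)] unfolding pos unfolding assms(2) by simp
  then show ?thesis
    using arshon_step_between[of n "K + q"] arshon_step_inside[of 0 n K] n by simp
qed

lemma letter_first:
  assumes "k < e" "i + k = n * K"
  shows "arshon n K = arshon n (K + q)"
proof -
  have pos: "i + k + (n * q + (n - 1)) = n * (K + q) + (n - 1)"
    using assms(2) by (simp add: distrib_left)
  have eq: "arshon n (n * K + 0) = arshon n (n * (K + q) + (n - 1))"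
    using repeatsD[OF rep assms(1)] unfolding pos unfolding assms(2) by simp
  have lt: "n - 1 < n" "0 < n" using n by auto
  have "[int (arshon n K) = int (arshon n (K + q))] (mod int n)"
  proof (cases "even K")
    case True
    then have odd: "odd (K + q)" using q by simp
    have "[int (arshon n K) + int 0 = int (arshon n (K + q)) - 1 - int (n - 1)] (mod int n)"
      using arshon_block_even[OF n lt(2) True] arshon_block_odd[OF n lt(1) odd] eq
      by (metis cong_sym cong_trans)
    then have "int n dvd int (arshon n K) + int 0 - (int (arshon n (K + q)) - 1 - int (n - 1)) - int n"
      by (simp only: cong_iff_dvd_diff dvd_diff dvd_refl)
    then show ?thesis using n by (simp add: cong_iff_dvd_diff of_nat_diff)
  next
    case False
    then have even: "even (K + q)" using q by simp
    have "[int (arshon n K) - 1 - int 0 = int (arshon n (K + q)) + int (n - 1)] (mod int n)"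
      using arshon_block_odd[OF n lt(2) False] arshon_block_even[OF n lt(1) even] eq
      by (metis cong_sym cong_trans)
    then have "int n dvd int (arshon n K) - 1 - int 0 - (int (arshon n (K + q)) + int (n - 1)) + int n"
      by (simp only: cong_iff_dvd_diff dvd_add dvd_refl)
    then show ?thesis using n by (simp add: cong_iff_dvd_diff of_nat_diff)
  qed
  then show ?thesis by (simp only: arshon_eq_iff_cong[OF n])
qed

text \<open>A longer stretch has at least \<open>3n - 1\<close> step comparisons, which cover the starts of three blocks
  or the ends of three blocks.  Both give three alternating steps.\<close>

lemma length_le: "e \<le> 3 * n - 1"
proof (rule ccontr)
  assume "\<not> e \<le> 3 * n - 1"
  then have e: "3 * n \<le> e" by simp
  define K t where "K = i div n" and "t = i mod n"
  have i: "i = n * K + t" and t: "t < n" using n by (auto simp: K_def t_def)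
  show False
  proof (cases "t = 0")
    case True
    have "arshon_step n (K + q) = 1 * (- 1) ^ K"
      using step_first[of 0 K] e n i True by simp
    moreover have "arshon_step n (K + q + 1) = 1 * (- 1) ^ (K + 1)"
      using step_first[of n "K + 1"] e n i True by (simp add: distrib_left ac_simps)
    moreover have "arshon_step n (K + q + 2) = 1 * (- 1) ^ (K + 2)"
      using step_first[of "2 * n" "K + 2"] e n i True by (simp add: distrib_left ac_simps)
    ultimately show False using sign_alternation_at_most_twice[OF n, of 1 "K + q" K] by simp
  next
    case False
    have "arshon_step n K = 1 * (- 1) ^ K"
      using step_last[of "n - 1 - t" K] e n i t False by simp
    moreover have "arshon_step n (K + 1) = 1 * (- 1) ^ (K + 1)"
      using step_last[of "n - 1 - t + n" "K + 1"] e n i t False by (simp add: distrib_left)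
    moreover have "arshon_step n (K + 2) = 1 * (- 1) ^ (K + 2)"
      using step_last[of "n - 1 - t + 2 * n" "K + 2"] e n i t False by (simp add: distrib_left)
    ultimately show False using sign_alternation_at_most_twice[OF n, of 1 K K] by simp
  qed
qed

text \<open>A stretch of \<open>n\<close> letters meets the start of some block \<open>K\<close>, and then \<open>a\<^sub>K = a\<^bsub>K+q\<^esub>\<close>.\<close>

lemma length_shift_1_3: "q = 1 \<or> q = 3 \<Longrightarrow> e \<le> n - 1 \<or> q = 3 \<and> n = 3"
proof (rule ccontr)
  assume q13: "q = 1 \<or> q = 3" and neg: "\<not> (e \<le> n - 1 \<or> q = 3 \<and> n = 3)"
  obtain k K where k: "k < n" and pos: "i + k = n * K + 0"
    using offset_hit[of 0 n i] n by auto
  have "k < e" using k neg n by linarith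
  from letter_first[OF this] pos have eq: "arshon n K = arshon n (K + q)" by simp
  show False
  proof (cases "q = 1")
    case True
    with eq arshon_Suc_neq[OF n, of K] show False by simp
  next
    case False
    with q13 eq neg arshon_eq_distance_3[OF n, of K] show False by simp
  qed
qed

lemma bound: "e * (2 * n - 2) \<le> n * (n * q + (n - 1))"
proof -
  obtain m where m: "n = m + 3" using n le_Suc_ex[of 3 n] by (auto simp: ac_simps)
  consider "q = 1 \<or> q = 3" | "5 \<le> q" using q by (auto elim!: oddE) linarith
  then show ?thesis
  proof cases
    case 1
    from length_shift_1_3[OF this] show ?thesis
    proof
      assume "e \<le> n - 1"
      moreover have "n * 1 + (n - 1) \<le> n * q + (n - 1)" using q by (auto elim!: oddE)
      ultimately show ?thesis by (rule bound_mono) (simp add: m algebra_simps)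
    next
      assume "q = 3 \<and> n = 3"
      then show ?thesis using length_le by simp
    qed
  next
    case 2
    then have "n * 5 + (n - 1) \<le> n * q + (n - 1)" by simp
    then show ?thesis by (rule bound_mono[OF length_le]) (simp add: m algebra_simps)
  qed
qed

end

subsection \<open>All periods\<close>

lemma arshon_block_eq_even_shift:
  assumes n: "n \<ge> 3" and t: "t < n" and q: "even q"
    and eq: "arshon n (n * K + t) = arshon n (n * (K + q) + t)"
  shows "arshon n K = arshon n (K + q)"
proof -
  have "[int (arshon n K) = int (arshon n (K + q))] (mod int n)"
  proof (cases "even K")
    case True
    then have "[int (arshon n K) + int t = int (arshon n (K + q)) + int t] (mod int n)"
      using arshon_block_even[OF n t, of K] arshon_block_even[OF n t, of "K + q"] eq q
      by (metis cong_sym cong_trans even_add)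
    then show ?thesis by (simp add: cong_iff_dvd_diff)
  next
    case False
    then have "[int (arshon n K) - 1 - int t = int (arshon n (K + q)) - 1 - int t] (mod int n)"
      using arshon_block_odd[OF n t, of K] arshon_block_odd[OF n t, of "K + q"] eq q
      by (metis cong_sym cong_trans even_add)
    then show ?thesis by (simp add: cong_iff_dvd_diff)
  qed
  then show ?thesis by (simp only: arshon_eq_iff_cong[OF n])
qed

lemma repeats_bound:
  assumes n: "n \<ge> 3"
  shows "p > 0 \<Longrightarrow> repeats (arshon n) i p e \<Longrightarrow> e * (2 * n - 2) \<le> n * p"
proof (induction p arbitrary: i e rule: less_induct)
  case (less p)
  define q r where "q = p div n" and "r = p mod n"
  have p: "p = n * q + r" and r: "r < n" using n by (auto simp: q_def r_def)
  note rep = less.prems(2)[unfolded p]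
  consider "q = 0" | "odd q" "r \<le> n - 2" | "odd q" "r = n - 1"
    | "even q" "q > 0" "r = 0" | "even q" "q > 0" "r = 1" | "even q" "q > 0" "2 \<le> r"
    using r by linarith
  then show ?case
  proof cases
    case 1
    with p r have "p < n" by simp
    from repeats_bound_short[OF n less.prems(1) this less.prems(2)] show ?thesis .
  next
    case 2
    from repeats_bound_odd_shift[OF n this rep] show ?thesis unfolding p .
  next
    case 3
    from rep 3 n interpret shift_by_minus_one n q i e by unfold_locales simp_all
    show ?thesis using bound unfolding p 3(2) .
  next
    case 4
    then have pq: "p = n * q" using p by simp
    from less.prems(2) have "repeats (arshon n) i (n * q) e" unfolding pq .
    then obtain E where E: "repeats (arshon n) (i div n) q E" "e \<le> n * E"
    proof (rule repeats_desubstitute[rotated])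
      show "0 < n" using n by simp
      show "arshon n K = arshon n (K + q)"
        if "t < n" "arshon n (n * K + t) = arshon n (n * (K + q) + t)" for K t
        using arshon_block_eq_even_shift[OF n that(1) 4(1) that(2)] .
    qed
    have "q < p" using pq 4 n by simp
    from less.IH[OF this 4(2) E(1)] have "E * (2 * n - 2) \<le> n * q" .
    then have "n * (E * (2 * n - 2)) \<le> n * (n * q)" by (rule mult_le_mono2)
    then have "n * E * (2 * n - 2) \<le> n * p" by (simp only: pq mult.assoc)
    then show ?thesis by (rule bound_mono[OF E(2) order_refl])
  next
    case 5
    from rep 5 n interpret shift_by_one n q i e by unfold_locales simp_all
    show ?thesis using bound unfolding p 5(3) .
  next
    case 6
    from repeats_bound_even_shift[OF n 6 r rep] show ?thesis unfolding p .
  qed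
qed

text \<open>The word starts with the blocks \<open>0 1 \<dots> (n-1)\<close>, \<open>0 (n-1) \<dots> 1\<close>, \<open>2 3 \<dots> (n-1) 0 1\<close>.  From position \<open>1\<close>
  it reads \<open>1, 2, \<dots>, n-1, 0\<close>, and so it does from position \<open>2n - 1\<close>, the end of the second block.\<close>

lemma repeats_extremal:
  assumes n: "n \<ge> 3"
  shows "repeats (arshon n) 1 (2 * n - 2) n"
  unfolding repeats_def
proof (intro allI impI)
  fix k assume k: "k < n"
  have n0: "0 < n" and n1: "n - 1 < n" using n by auto
  have letters: "[int (arshon n 0) = 0] (mod int n)" "[int (arshon n 1) = 1] (mod int n)"
      "[int (arshon n 2) = 2] (mod int n)"
  proof -
    have a0: "arshon n 0 = 0" using arshon_eq_nth[of n 0 0] n by simp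
    then show "[int (arshon n 0) = 0] (mod int n)" by simp
    show "[int (arshon n 1) = 1] (mod int n)" "[int (arshon n 2) = 2] (mod int n)"
      using arshon_block_even[of n 1 0] arshon_block_even[of n 2 0] n a0 by (simp_all add: numeral_2_eq_2)
  qed
  \<comment> \<open>blocks 0, 1 and 2 contain all positions involved\<close>
  have block0: "[int (arshon n t) = int t] (mod int n)" if "t < n" for t
    using arshon_block_even[OF n that, of 0] letters(1)
    by simp (metis add.left_neutral cong_add_rcancel cong_trans)
  have block1: "[int (arshon n (n * 1 + t)) = - int t] (mod int n)" if "t < n" for t
  proof -
    have "[int (arshon n 1) - 1 - int t = 1 - 1 - int t] (mod int n)"
      by (intro cong_diff letters cong_refl)
    with arshon_block_odd[OF n that, of 1] show ?thesis by (auto intro: cong_trans)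
  qed
  have block2: "[int (arshon n (n * 2 + t)) = 2 + int t] (mod int n)" if "t < n" for t
  proof -
    have "[int (arshon n 2) + int t = 2 + int t] (mod int n)"
      by (intro cong_add letters cong_refl)
    with arshon_block_even[OF n that, of 2] show ?thesis by (auto intro: cong_trans)
  qed
  have left: "[int (arshon n (1 + k)) = 1 + int k] (mod int n)"
  proof (cases "k = n - 1")
    case True
    have "1 + int k = int n" using True n by simp
    then show ?thesis using block1[OF n0] True n by (simp add: cong_def)
  next
    case False
    then show ?thesis using block0[of "1 + k"] k by simp
  qed
  moreover have "[int (arshon n (1 + k + (2 * n - 2))) = 1 + int k] (mod int n)"
  proof (cases "k = 0")
    case True
    then have pos: "1 + k + (2 * n - 2) = n * 1 + (n - 1)" using n by simp
    have "[- int (n - 1) = 1] (mod int n)" using n by (simp add: cong_iff_dvd_diff of_nat_diff)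
    with block1[OF n1] True show ?thesis unfolding pos by (auto intro: cong_trans)
  next
    case False
    then have pos: "1 + k + (2 * n - 2) = n * 2 + (k - 1)" using n by simp
    show ?thesis unfolding pos using block2[of "k - 1"] k False by (simp add: of_nat_diff)
  qed
  ultimately show "arshon n (1 + k) = arshon n (1 + k + (2 * n - 2))"
    unfolding arshon_eq_iff_cong[OF n] by (metis cong_sym cong_trans)
qed

section \<open>The Thue--Morse word is overlap-free\<close>

lemma thue_morse_less_2: "thue_morse i < 2"
proof -
  show ?thesis
  proof (cases "even i")
    case True
    then obtain k where "i = 2 * k" by (elim evenE)
    with thue_morse_fixed_point(2)[of k] show ?thesis by (auto simp: thue_morse_morphism_def split: if_splits)
  next
    case False
    then obtain k where "i = 2 * k + 1" by (elim oddE)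
    with thue_morse_fixed_point(2)[of k] show ?thesis by (auto simp: thue_morse_morphism_def split: if_splits)
  qed
qed

lemma thue_morse_double:
  "thue_morse (2 * k) = thue_morse k" "thue_morse (2 * k + 1) = 1 - thue_morse k"
proof -
  consider "thue_morse k = 0" | "thue_morse k = 1" using thue_morse_less_2[of k] by linarith
  then show "thue_morse (2 * k) = thue_morse k" "thue_morse (2 * k + 1) = 1 - thue_morse k"
    by (cases; use thue_morse_fixed_point(2)[of k] in \<open>simp add: thue_morse_morphism_def\<close>)+
qed

lemma thue_morse_pair_neq: "thue_morse (2 * k) \<noteq> thue_morse (2 * k + 1)"
  using thue_morse_double[of k] thue_morse_less_2[of k] by arith

text \<open>Six alternating letters contain two consecutive changes from an odd position \<open>2k + 1\<close> to the next,
  and each of them says that the letters at \<open>k\<close> and \<open>k + 1\<close> are equal.  This yields three equal letters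
  in a row, two of which form a pair \<open>2m\<close>, \<open>2m + 1\<close>.\<close>

lemma thue_morse_not_alternating:
  "\<exists>j<5. thue_morse (i + j) = thue_morse (i + j + 1)"
proof (rule ccontr)
  assume "\<not> ?thesis"
  then have neq: "\<And>j. j < 5 \<Longrightarrow> thue_morse (i + j) \<noteq> thue_morse (i + j + 1)" by blast
  have *: "thue_morse k = thue_morse (k + 1)" if "thue_morse (2 * k + 1) \<noteq> thue_morse (2 * k + 1 + 1)" for k
    using that thue_morse_double[of k] thue_morse_double(1)[of "k + 1"]
      thue_morse_less_2[of k] thue_morse_less_2[of "k + 1"]
    by (auto simp: less_2_cases_iff)
  define k where "k = i div 2"
  have "\<exists>l. thue_morse l = thue_morse (l + 1) \<and> thue_morse (l + 1) = thue_morse (l + 2)"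
  proof (cases "even i")
    case True
    then have "i = 2 * k" by (simp add: k_def)
    with neq[of 1] neq[of 3] *[of k] *[of "k + 1"] show ?thesis
      by (intro exI[of _ k]) (simp add: numeral_eq_Suc)
  next
    case False
    then have "i = 2 * k + 1" by (simp add: k_def)
    with neq[of 0] neq[of 2] *[of k] *[of "k + 1"] show ?thesis
      by (intro exI[of _ k]) (simp add: numeral_eq_Suc)
  qed
  then obtain l where l: "thue_morse l = thue_morse (l + 1)" "thue_morse (l + 1) = thue_morse (l + 2)"
    by blast
  show False
  proof (cases "even l")
    case True
    then obtain m where "l = 2 * m" by (elim evenE)
    with l(1) thue_morse_pair_neq[of m] show False by simp
  next
    case False
    then obtain m where "l = 2 * m + 1" by (elim oddE)
    with l(2) thue_morse_pair_neq[of "m + 1"] show False by (simp add: numeral_eq_Suc)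
  qed
qed

lemma thue_morse_eq_iff_double:
  "thue_morse (2 * k) = thue_morse (2 * l) \<longleftrightarrow> thue_morse k = thue_morse l"
  "thue_morse (2 * k + 1) = thue_morse (2 * l + 1) \<longleftrightarrow> thue_morse k = thue_morse l"
  using thue_morse_less_2[of k] thue_morse_less_2[of l] unfolding thue_morse_double
  by (simp, linarith)

text \<open>An even period is halved.  For an odd period \<open>p\<close> and \<open>e > p\<close>, one of the positions \<open>i + k\<close> and
  \<open>i + k + p\<close> is even, so the letter changes there, hence at both.  The word then alternates
  over \<open>2p\<close> steps, which is impossible for \<open>p \<ge> 3\<close>; and for \<open>p = 1\<close> a change contradicts the match.\<close>

lemma thue_morse_overlap_free:
  "p > 0 \<Longrightarrow> repeats thue_morse i p e \<Longrightarrow> e \<le> p"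
proof (induction p arbitrary: i e rule: less_induct)
  case (less p)
  note rep = less.prems(2)
  show ?case
  proof (cases "even p")
    case True
    then obtain q where q: "p = 2 * q" by (elim evenE)
    have block: "thue_morse K = thue_morse (K + q)"
      if t: "t < 2" and eq: "thue_morse (2 * K + t) = thue_morse (2 * (K + q) + t)" for K t
    proof -
      consider "t = 0" | "t = 1" using t by linarith
      then show ?thesis
        using eq thue_morse_eq_iff_double[of K "K + q"] by cases (simp_all only: add_0_right)
    qed
    obtain E where E: "repeats thue_morse (i div 2) q E" "e \<le> 2 * E"
      by (rule repeats_desubstitute[OF _ rep[unfolded q] block]) simp_all
    have "E \<le> q" using less.IH[of q "i div 2" E] less.prems(1) q E(1) by simp
    with E(2) q show ?thesis by simp
  next
    case False
    show ?thesis
    proof (rule ccontr)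
      assume "\<not> e \<le> p"
      then have e: "p < e" by simp
      have change: "thue_morse (i + k) \<noteq> thue_morse (i + k + 1)
          \<longleftrightarrow> thue_morse (i + k + p) \<noteq> thue_morse (i + k + p + 1)" if "k < p" for k
        using repeatsD[OF rep, of k] repeatsD[OF rep, of "k + 1"] that e by (simp add: ac_simps)
      have alt1: "thue_morse (i + k) \<noteq> thue_morse (i + k + 1)"
        "thue_morse (i + k + p) \<noteq> thue_morse (i + k + p + 1)" if "k < p" for k
      proof -
        have "even (i + k) \<or> even (i + k + p)" using False by auto
        then have "thue_morse (i + k) \<noteq> thue_morse (i + k + 1)
          \<or> thue_morse (i + k + p) \<noteq> thue_morse (i + k + p + 1)"
          using thue_morse_pair_neq by (metis evenE)
        with change[OF that] show "thue_morse (i + k) \<noteq> thue_morse (i + k + 1)"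
          "thue_morse (i + k + p) \<noteq> thue_morse (i + k + p + 1)" by auto
      qed
      have alt: "thue_morse (i + j) \<noteq> thue_morse (i + j + 1)" if "j < 2 * p" for j
      proof (cases "j < p")
        case False
        then show ?thesis using alt1(2)[of "j - p"] that by (simp add: ac_simps)
      qed (rule alt1(1))
      show False
      proof (cases "p = 1")
        case True
        with alt1(1)[of 0] repeatsD[OF rep, of 0] e show False by simp
      next
        case False
        with less.prems(1) \<open>odd p\<close> have "3 \<le> p" by (auto elim!: oddE)
        obtain j where "j < 5" "thue_morse (i + j) = thue_morse (i + j + 1)"
          using thue_morse_not_alternating[of i] by blast
        moreover from this \<open>3 \<le> p\<close> have "j < 2 * p" by linarith
        ultimately show False using alt by blast
      qed
    qed
  qed
qed

section \<open>The critical exponent\<close>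

theorem theorem1:
  fixes n :: nat
  assumes "n \<ge> 2"
  shows "critical_exponent (arshon n) = ereal ((3 * real n - 2) / (2 * real n - 2)) \<and>
    (\<exists>j\<ge>1. is_power ((3 * of_nat n - 2) / (2 * of_nat n - 2)) (map (arshon n) [1..<Suc j]))"
proof (cases "n = 2")
  case True
  have rep: "repeats (arshon n) 1 1 1"
  proof -
    have "thue_morse 1 = 1" "thue_morse 2 = 1"
      using thue_morse_double[of 0] thue_morse_double[of 1] thue_morse_fixed_point(1) by simp_all
    then show ?thesis using True by (simp add: repeats_def arshon_def numeral_2_eq_2)
  qed
  have "critical_exponent (arshon n) = ereal (real (1 + 1) / real 1)"
  proof (rule critical_exponent_eqI[OF _ _ _ rep])
    show "e * 1 \<le> 1 * p" if "0 < p" "repeats (arshon n) i p e" for i p e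
      using thue_morse_overlap_free[of p i e] that True by (simp add: arshon_def)
  qed simp_all
  moreover have "is_power (of_nat (1 + 1) / of_nat 1) (map (arshon n) [1..<1 + 1 + 1])"
    by (rule is_power_map_repeats[OF rep]) simp_all
  ultimately show ?thesis using True by (intro conjI exI[of _ 2]) (simp_all add: numeral_3_eq_3)
next
  case False
  with assms have n: "n \<ge> 3" by simp
  have reals: "real (2 * n - 2 + n) = 3 * real n - 2" "real (2 * n - 2) = 2 * real n - 2"
    and rats: "(of_nat (2 * n - 2 + n) :: rat) = 3 * of_nat n - 2"
      "(of_nat (2 * n - 2) :: rat) = 2 * of_nat n - 2"
    and pos: "0 < 2 * n - 2" "n \<le> 2 * n - 2"
    and end_pos: "1 + (2 * n - 2) + n = Suc (3 * n - 2)" "1 \<le> 3 * n - 2"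
    using n by (simp_all add: of_nat_diff)
  have "critical_exponent (arshon n) = ereal (real (2 * n - 2 + n) / real (2 * n - 2))"
  proof (rule critical_exponent_eqI[OF _ pos repeats_extremal[OF n]])
    show "e * (2 * n - 2) \<le> n * p" if "0 < p" "repeats (arshon n) i p e" for i p e
      using that by (rule repeats_bound[OF n])
  qed
  then have "critical_exponent (arshon n) = ereal ((3 * real n - 2) / (2 * real n - 2))"
    unfolding reals .
  moreover note is_power_map_repeats[OF repeats_extremal[OF n] pos, unfolded rats end_pos(1)]
  ultimately show ?thesis using end_pos(2) by blast
qed

end
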